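(* Let $K\ge 1$ be an integer, $N_0>0$, $P>0$, $r^*\ge 0$, and let $h_1,\dots,h_K$ be nonzero complex numbers with $|h_1|\ge |h_2|\ge\dots\ge|h_K|$. Define $$P_N^* = (e^{r^*}-1)N_0\sum_{i=0}^{K-1}\frac{e^{ir^*}}{|h_{K-i}|^2}.$$ If $P_N^*\le P$, then the NOMA optimization problem (maximize $\sum_{i=1}^K r_i$ over $P_1,\dots,P_K\ge 0$ subject to $$r_i=\ln\Big(1+\frac{P_i|h_i|^2}{N_0+|h_i|^2\sum_{j=1}^{i-1}P_j}\Big)\ (1\le i\le K),\qquad \sum_{i=1}^K P_i\le P,\qquad \min_i r_i\ge r^* )$$ is feasible, and its optimal value $R_N$ is $$R_N=Kr^*+\ln\Big(1+\frac{(P-P_N^* )|h_1|^2}{N_0e^{Kr^*}}\Big).$$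
   Context: Here $K$ is the number of users, $h_i$ the channel coefficient of user $i$, $N_0$ the noise power, $P$ the total power, $P_i$ the power allocated to user $i$, $r_i$ the rate of user $i$ (in nats) and $r^*$ the minimum rate every user must attain. For $i=1$ the empty sum $\sum_{j=1}^{0}P_j$ equals $0$. *)

theory Defs
  imports "HOL-Library.FuncSet" "HOL-Library.Extended_Real" Complex_Main
begin

text \<open>
  Users are the naturals in \<open>{1..K}\<close>; the value \<open>h 0\<close> plays no role. A power allocation,
  i.e. a vector of nonnegative reals indexed by the users, is an element of
  \<open>{1..K} \<rightarrow>\<^sub>E {0..}\<close> (extensional functions, so that vectors and functions correspond one to one).
\<close>

definition noma_rate :: "(nat \<Rightarrow> complex) \<Rightarrow> real \<Rightarrow> (nat \<Rightarrow> real) \<Rightarrow> nat \<Rightarrow> real" where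
  "noma_rate h N0 p i =
     ln (1 + p i * (cmod (h i))\<^sup>2 / (N0 + (cmod (h i))\<^sup>2 * (\<Sum>j = 1..<i. p j)))"

definition noma_sum_rate :: "nat \<Rightarrow> (nat \<Rightarrow> complex) \<Rightarrow> real \<Rightarrow> (nat \<Rightarrow> real) \<Rightarrow> real" where
  "noma_sum_rate K h N0 p = (\<Sum>i = 1..K. noma_rate h N0 p i)"

definition noma_feasible ::
    "nat \<Rightarrow> (nat \<Rightarrow> complex) \<Rightarrow> real \<Rightarrow> real \<Rightarrow> real \<Rightarrow> (nat \<Rightarrow> real) set" where
  "noma_feasible K h N0 P r =
     {p \<in> {1..K} \<rightarrow>\<^sub>E {0..}. (\<Sum>i = 1..K. p i) \<le> P \<and> Min (noma_rate h N0 p ` {1..K}) \<ge> r}"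

text \<open>
  The optimal value is taken in the extended reals, where the supremum is meaningful without
  presupposing nonemptiness or boundedness (over \<open>real\<close> it would be unspecified in those cases).
\<close>

definition noma_optimal_value ::
    "nat \<Rightarrow> (nat \<Rightarrow> complex) \<Rightarrow> real \<Rightarrow> real \<Rightarrow> real \<Rightarrow> ereal" where
  "noma_optimal_value K h N0 P r =
     (SUP p \<in> noma_feasible K h N0 P r. ereal (noma_sum_rate K h N0 p))"

definition noma_min_power :: "nat \<Rightarrow> (nat \<Rightarrow> complex) \<Rightarrow> real \<Rightarrow> real \<Rightarrow> real" where
  "noma_min_power K h N0 r =
     (exp r - 1) * N0 * (\<Sum>i = 0..K - 1. exp (real i * r) / (cmod (h (K - i)))\<^sup>2)"

end

theory Submission
  imports Defs
begin

text \<open>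
  Write \<open>a\<^sub>i = N\<^sub>0 / |h\<^sub>i|\<^sup>2\<close>, \<open>S\<^sub>k = P\<^sub>1 + \<dots> + P\<^sub>k\<close> and \<open>E = exp r\<close>. Then
  \<open>exp r\<^sub>k = (a\<^sub>k + S\<^sub>k) / (a\<^sub>k + S\<^sub>k\<^sub>-\<^sub>1)\<close>, and the least power serving the first \<open>k\<close> users obeys
  \<open>M\<^sub>k = E M\<^sub>k\<^sub>-\<^sub>1 + (E - 1) a\<^sub>k\<close>. Since \<open>a\<close> is nondecreasing, \<open>E\<^sup>k a\<^sub>1 \<le> M\<^sub>k + a\<^sub>k\<^sub>+\<^sub>1\<close>, and this makes
  the bound \<open>exp (r\<^sub>1 + \<dots> + r\<^sub>k) \<le> E\<^sup>k + (S\<^sub>k - M\<^sub>k) / a\<^sub>1\<close> propagate by induction on \<open>k\<close>. Equality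
  holds when every user except the first is served at exactly the minimum rate.
\<close>

section \<open>Recursion for the minimum power and bound on products of ratios\<close>

text \<open>Ratio \<open>E\<close> for user \<open>Suc k\<close> means
  \<open>a (Suc k) + S' = E * (a (Suc k) + S)\<close>, where \<open>S\<close> and \<open>S'\<close>
  are the total powers before and after that user; solving for \<open>S'\<close> gives the recursive
  clause.\<close>

fun cum_min_power :: "(nat \<Rightarrow> real) \<Rightarrow> real \<Rightarrow> nat \<Rightarrow> real" where
  "cum_min_power a E 0 = 0"
| "cum_min_power a E (Suc k) = E * cum_min_power a E k + (E - 1) * a (Suc k)"

text \<open>Each later user multiplies the power already spent by \<open>E\<close>, so user
  \<open>k - i\<close>, followed by \<open>i\<close> others, enters with weight
  \<open>E ^ i\<close>.\<close>

lemma cum_min_power_closed_form: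
  "cum_min_power a E k = (E - 1) * (\<Sum>i<k. E ^ i * a (k - i))"
proof (induction k)
  case (Suc k)
  have "(\<Sum>i<Suc k. E ^ i * a (Suc k - i)) = a (Suc k) + E * (\<Sum>i<k. E ^ i * a (k - i))"
    by (simp add: sum.lessThan_Suc_shift sum_distrib_left mult.assoc del: sum.lessThan_Suc)
  then show ?case
    unfolding cum_min_power.simps Suc.IH by (simp only:) (simp add: algebra_simps)
qed simp

lemma noma_min_power_eq_cum_min_power:
  assumes "K \<ge> 1"
  shows "noma_min_power K h N0 r = cum_min_power (\<lambda>i. N0 / (cmod (h i))\<^sup>2) (exp r) K"
proof -
  \<comment> \<open>Here \<open>K \<ge> 1\<close> matters: truncated subtraction turns
    \<open>{0..K - 1}\<close> into \<open>{0}\<close> at \<open>K = 0\<close>.\<close>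
  have "{0..K - 1} = {..<K}"
    using assms by auto
  then show ?thesis
    unfolding noma_min_power_def cum_min_power_closed_form exp_of_nat_mult
    by (simp add: sum_distrib_left mult_ac)
qed

lemma cum_min_power_nonneg:
  assumes "E \<ge> 1" and "\<And>i. i \<in> {1..k} \<Longrightarrow> a i \<ge> 0"
  shows "cum_min_power a E k \<ge> 0"
  using assms by (induction k) auto

text \<open>Multiplying the bound at \<open>k\<close> by \<open>E\<close> yields the next minimum
  power plus \<open>a (Suc k)\<close>, and monotonicity of \<open>a\<close> does the rest. In
  \<open>prod_ratio_le\<close> this caps the gain from raising a ratio above
  \<open>E\<close>.\<close>

lemma power_le_cum_min_power:
  assumes "E \<ge> 1" and "\<And>i. i \<in> {1..k} \<Longrightarrow> a i \<le> a (Suc i)"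
  shows "E ^ k * a 1 \<le> cum_min_power a E k + a (Suc k)"
  using assms(2)
proof (induction k)
  case (Suc k)
  have "E ^ k * a 1 \<le> cum_min_power a E k + a (Suc k)"
    using Suc by simp
  then have "E * (E ^ k * a 1) \<le> E * (cum_min_power a E k + a (Suc k))"
    using \<open>E \<ge> 1\<close> by (intro mult_left_mono) auto
  moreover have "a (Suc k) \<le> a (Suc (Suc k))"
    using Suc.prems by simp
  ultimately show ?case
    by (simp add: algebra_simps)
qed simp

text \<open>The bound is affine in \<open>S k\<close>, and \<open>S (Suc k)\<close> is affine in
  \<open>S k\<close> with the next ratio \<open>t\<close> as factor. After multiplying the bound by
  \<open>t\<close>, the terms in \<open>S k\<close> therefore cancel, leaving
  \<open>power_le_cum_min_power\<close> scaled by \<open>t - E\<close>.\<close>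

lemma prod_ratio_le:
  fixes a S :: "nat \<Rightarrow> real"
  assumes "E \<ge> 1" and "S 0 = 0"
    and "\<And>i. i \<in> {1..k} \<Longrightarrow> a i > 0"
    and "\<And>i. i \<in> {1..<k} \<Longrightarrow> a i \<le> a (Suc i)"
    and "\<And>i. i < k \<Longrightarrow> S i \<ge> 0"
    and "\<And>i. i < k \<Longrightarrow> E \<le> (a (Suc i) + S (Suc i)) / (a (Suc i) + S i)"
  shows "(\<Prod>i<k. (a (Suc i) + S (Suc i)) / (a (Suc i) + S i))
    \<le> E ^ k + (S k - cum_min_power a E k) / a 1"
  using assms(3-)
proof (induction k)
  case 0
  show ?case
    using \<open>S 0 = 0\<close> by simp
next
  case (Suc k)
  define b t M where "b = a (Suc k)" and "t = (b + S (Suc k)) / (b + S k)"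
    and "M = cum_min_power a E k"
  have pos: "a 1 > 0" "b + S k > 0"
    using Suc.prems(1)[of 1] Suc.prems(1)[of "Suc k"] Suc.prems(3)[of k] by (simp_all add: b_def)
  have "E \<le> t"
    using Suc.prems(4)[of k] by (simp add: b_def t_def)
  have "E ^ k * a 1 \<le> M + b"
    unfolding M_def b_def using \<open>E \<ge> 1\<close> Suc.prems(2) by (intro power_le_cum_min_power) auto
  then have "(t - E) * (E ^ k * a 1) \<le> (t - E) * (M + b)"
    using \<open>E \<le> t\<close> by (intro mult_left_mono) auto
  moreover have "S (Suc k) = t * S k + (t - 1) * b"
  proof -
    have "t * (b + S k) = b + S (Suc k)"
      using pos by (simp add: t_def)
    then show ?thesis
      by (simp add: algebra_simps)
  qed
  \<comment> \<open>The right side minus the left side equals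
    \<open>(t - E) * (M + b - E ^ k * a 1)\<close>.\<close>
  ultimately have step: "t * (E ^ k * a 1 + (S k - M)) \<le>
      E ^ Suc k * a 1 + (S (Suc k) - (E * M + (E - 1) * b))"
    by (simp add: algebra_simps)
  have "(\<Prod>i<k. (a (Suc i) + S (Suc i)) / (a (Suc i) + S i)) \<le> E ^ k + (S k - M) / a 1"
    unfolding M_def using Suc.prems by (intro Suc.IH) auto
  then have "(\<Prod>i<Suc k. (a (Suc i) + S (Suc i)) / (a (Suc i) + S i))
      \<le> (E ^ k + (S k - M) / a 1) * t"
    unfolding prod.lessThan_Suc b_def[symmetric] t_def[symmetric]
    using \<open>E \<ge> 1\<close> \<open>E \<le> t\<close> by (intro mult_right_mono) auto
  also have "\<dots> = t * (E ^ k * a 1 + (S k - M)) / a 1"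
    using pos by (simp add: field_simps)
  also have "\<dots> \<le> (E ^ Suc k * a 1 + (S (Suc k) - (E * M + (E - 1) * b))) / a 1"
    using step pos by (intro divide_right_mono) auto
  also have "\<dots> = E ^ Suc k + (S (Suc k) - cum_min_power a E (Suc k)) / a 1"
    using pos by (simp add: add_divide_distrib b_def M_def)
  finally show ?case .
qed

section \<open>From rates to ratios of cumulative powers, and the upper bound\<close>

text \<open>Dividing numerator and denominator by the squared channel gain leaves cumulative powers
  shifted by the normalized noise \<open>a\<close>.\<close>

lemma noma_rate_eq_ln_ratio:
  assumes "h (Suc i) \<noteq> 0" and "N0 > 0" and "\<And>j. j \<in> {1..i} \<Longrightarrow> p j \<ge> 0"
    and "a = N0 / (cmod (h (Suc i)))\<^sup>2"
  shows "noma_rate h N0 p (Suc i) =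
    ln ((a + (\<Sum>j = 1..Suc i. p j)) / (a + (\<Sum>j = 1..i. p j)))"
proof -
  define c s where "c = (cmod (h (Suc i)))\<^sup>2" and "s = (\<Sum>j = 1..i. p j)"
  have "c > 0" "s \<ge> 0"
    using assms by (auto simp: c_def s_def intro!: sum_nonneg)
  moreover from this have "a > 0" "c * a = N0"
    using \<open>N0 > 0\<close> assms(4) by (simp_all flip: c_def)
  ultimately have "N0 + c * s > 0" "a + s > 0" "c * (a + s) = N0 + c * s"
    using \<open>N0 > 0\<close> by (auto simp: add_pos_nonneg distrib_left)
  then have "1 + p (Suc i) * c / (N0 + c * s) = (a + (s + p (Suc i))) / (a + s)"
    using \<open>c > 0\<close> by (simp add: divide_simps) (simp add: algebra_simps)
  moreover have "{1..<Suc i} = {1..i}"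
    by auto
  ultimately show ?thesis
    by (simp add: noma_rate_def c_def s_def)
qed

lemma noma_sum_rate_Suc: "noma_sum_rate K h N0 p = (\<Sum>i<K. noma_rate h N0 p (Suc i))"
  by (simp add: noma_sum_rate_def sum.atLeast1_atMost_eq)

lemma noma_feasible_iff:
  assumes "K \<ge> 1"
  shows "p \<in> noma_feasible K h N0 P r \<longleftrightarrow>
    p \<in> {1..K} \<rightarrow>\<^sub>E {0..} \<and> (\<Sum>i = 1..K. p i) \<le> P \<and> (\<forall>i<K. r \<le> noma_rate h N0 p (Suc i))"
proof -
  have "Min (noma_rate h N0 p ` {1..K}) \<ge> r \<longleftrightarrow> (\<forall>i\<in>{1..K}. r \<le> noma_rate h N0 p i)"
    using assms by (subst Min_ge_iff) auto
  also have "\<dots> \<longleftrightarrow> (\<forall>i<K. r \<le> noma_rate h N0 p (Suc i))"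
    by (simp only: ball_simps lessThan_iff flip: image_Suc_lessThan) auto
  finally show ?thesis
    by (simp add: noma_feasible_def)
qed

text \<open>Exponentiation turns the sum rate into the product bounded by
  \<open>prod_ratio_le\<close>, and each minimum-rate constraint into a ratio of at least
  \<open>exp r\<close>.\<close>

lemma noma_sum_rate_le:
  assumes "K \<ge> 1" and "N0 > 0" and "r \<ge> 0"
    and h_nz: "\<And>i. i \<in> {1..K} \<Longrightarrow> h i \<noteq> 0"
    and h_mono: "\<And>i. i \<in> {1..<K} \<Longrightarrow> cmod (h i) \<ge> cmod (h (Suc i))"
    and feas: "p \<in> noma_feasible K h N0 P r"
  shows "exp (noma_sum_rate K h N0 p) \<le>
    exp (real K * r) + (P - noma_min_power K h N0 r) * (cmod (h 1))\<^sup>2 / N0"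
proof -
  define a where "a i = N0 / (cmod (h i))\<^sup>2" for i
  define S where "S i = (\<Sum>j = 1..i. p j)" for i
  have p: "p j \<ge> 0" if "j \<in> {1..K}" for j
    using feas that by (auto simp: noma_feasible_def PiE_iff)
  have S_nonneg: "S i \<ge> 0" if "i \<le> K" for i
    using that p by (auto simp: S_def intro!: sum_nonneg)
  have a_pos: "a i > 0" if "i \<in> {1..K}" for i
    using that h_nz \<open>N0 > 0\<close> by (simp add: a_def)
  have a_mono: "a i \<le> a (Suc i)" if "i \<in> {1..<K}" for i
    unfolding a_def using that h_mono[of i] h_nz[of "Suc i"] h_nz[of i] \<open>N0 > 0\<close>
    by (intro divide_left_mono power_mono) auto
  have rate: "exp (noma_rate h N0 p (Suc i)) = (a (Suc i) + S (Suc i)) / (a (Suc i) + S i)"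
    if "i < K" for i
  proof -
    have "(a (Suc i) + S (Suc i)) / (a (Suc i) + S i) > 0"
      using that a_pos[of "Suc i"] S_nonneg[of i] S_nonneg[of "Suc i"]
      by (intro divide_pos_pos add_pos_nonneg) auto
    moreover have "noma_rate h N0 p (Suc i) = ln ((a (Suc i) + S (Suc i)) / (a (Suc i) + S i))"
      unfolding S_def using that p h_nz \<open>N0 > 0\<close>
      by (intro noma_rate_eq_ln_ratio) (auto simp: a_def)
    ultimately show ?thesis
      by (simp add: exp_ln)
  qed
  have "exp (noma_sum_rate K h N0 p) = (\<Prod>i<K. (a (Suc i) + S (Suc i)) / (a (Suc i) + S i))"
    by (simp add: noma_sum_rate_Suc exp_sum rate)
  also have "\<dots> \<le> exp r ^ K + (S K - cum_min_power a (exp r) K) / a 1"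
  proof (rule prod_ratio_le)
    fix i assume "i < K"
    then have "r \<le> noma_rate h N0 p (Suc i)"
      using feas \<open>K \<ge> 1\<close> by (simp add: noma_feasible_iff)
    then show "exp r \<le> (a (Suc i) + S (Suc i)) / (a (Suc i) + S i)"
      using rate[OF \<open>i < K\<close>] by (metis exp_le_cancel_iff)
  qed (use \<open>r \<ge> 0\<close> a_pos a_mono S_nonneg in \<open>auto simp: S_def\<close>)
  \<comment> \<open>The power budget enters here, as \<open>S K \<le> P\<close>; dividing by
    \<open>a 1 > 0\<close> preserves the inequality.\<close>
  also have "\<dots> \<le> exp r ^ K + (P - cum_min_power a (exp r) K) / a 1"
    using feas a_pos[of 1] \<open>K \<ge> 1\<close>
    by (intro add_left_mono divide_right_mono) (auto simp: noma_feasible_def S_def)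
  also have "\<dots> = exp (real K * r) + (P - noma_min_power K h N0 r) * (cmod (h 1))\<^sup>2 / N0"
    using noma_min_power_eq_cum_min_power[OF \<open>K \<ge> 1\<close>, of h N0 r]
    by (simp add: exp_of_nat_mult a_def [abs_def])
  finally show ?thesis .
qed

section \<open>An allocation attaining the bound\<close>

text \<open>The allocation is built from its cumulative powers \<open>S\<close>, since prescribed
  ratios determine these recursively; the individual powers are their differences.\<close>

lemma noma_sum_rate_attained:
  assumes "K \<ge> 1" and "N0 > 0" and "r \<ge> 0"
    and h_nz: "\<And>i. i \<in> {1..K} \<Longrightarrow> h i \<noteq> 0"
    and le: "noma_min_power K h N0 r \<le> P"
  shows "\<exists>p \<in> noma_feasible K h N0 P r. exp (noma_sum_rate K h N0 p) =
    exp (real K * r) + (P - noma_min_power K h N0 r) * (cmod (h 1))\<^sup>2 / N0"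
proof -
  define a where "a i = N0 / (cmod (h i))\<^sup>2" for i
  define E where "E = exp r"
  define M where "M = cum_min_power a E"
  \<comment> \<open>The whole surplus power goes to user 1; serving user \<open>i\<close> at the minimum rate then
      requires the cumulative surplus to grow by the factor \<open>E\<close>.\<close>
  define D where "D = (P - M K) / E ^ (K - 1)"
  \<comment> \<open>Index 0 is set apart: with truncated subtraction the second branch would give
    \<open>S 0 = D\<close>.\<close>
  define S where "S i = (if i = 0 then 0 else M i + D * E ^ (i - 1))" for i
  define p where "p = (\<lambda>i\<in>{1..K}. S i - S (i - 1))"
  have "E \<ge> 1"
    using \<open>r \<ge> 0\<close> by (simp add: E_def)
  have M_K: "M K = noma_min_power K h N0 r"
    using noma_min_power_eq_cum_min_power[OF \<open>K \<ge> 1\<close>] by (simp add: M_def E_def a_def [abs_def])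
  have "D \<ge> 0"
    using le \<open>E \<ge> 1\<close> by (simp add: D_def M_K)
  have a_pos: "a i > 0" if "i \<in> {1..K}" for i
    using that h_nz \<open>N0 > 0\<close> by (simp add: a_def)
  have S_nonneg: "S i \<ge> 0" if "i \<le> K" for i
  proof -
    have "M i \<ge> 0"
      unfolding M_def using \<open>E \<ge> 1\<close> that a_pos
      by (intro cum_min_power_nonneg) (auto intro: less_imp_le)
    then show ?thesis
      using \<open>D \<ge> 0\<close> \<open>E \<ge> 1\<close> by (simp add: S_def)
  qed
  \<comment> \<open>Surplus enters only in the step to user 1; afterwards both summands of
    \<open>S\<close> follow the recursion with factor \<open>E\<close>.\<close>
  have S_Suc: "S (Suc i) = E * S i + (E - 1) * a (Suc i) + (if i = 0 then D else 0)" for i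
    by (cases i) (auto simp: S_def M_def algebra_simps)
  have ratio: "(a (Suc i) + S (Suc i)) / (a (Suc i) + S i) = (if i = 0 then E + D / a 1 else E)"
    if "i < K" for i
  proof -
    have "a (Suc i) + S i > 0"
      using that a_pos[of "Suc i"] S_nonneg[of i] by (intro add_pos_nonneg) auto
    moreover have "S 0 = 0"
      by (simp add: S_def)
    ultimately show ?thesis
      by (auto simp: S_Suc field_simps)
  qed
  have ratio_ge: "(a (Suc i) + S (Suc i)) / (a (Suc i) + S i) \<ge> E" if "i < K" for i
    unfolding ratio[OF that] using \<open>D \<ge> 0\<close> a_pos[of 1] \<open>K \<ge> 1\<close> by simp
  have p_nonneg: "p i \<ge> 0" if i: "i \<in> {1..K}" for i
  proof -
    obtain j where j: "i = Suc j"
      using i by (cases i) auto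
    have "S i - S j = (E - 1) * (S j + a i) + (if j = 0 then D else 0)"
      by (simp add: j S_Suc algebra_simps)
    moreover have "\<dots> \<ge> 0"
      using \<open>E \<ge> 1\<close> \<open>D \<ge> 0\<close> S_nonneg[of j] a_pos[OF i] i j by simp
    ultimately show ?thesis
      using i j by (simp add: p_def)
  qed
  have sum_p: "(\<Sum>j = 1..i. p j) = S i" if "i \<le> K" for i
    using that by (induction i) (auto simp: p_def S_def)
  have rate: "noma_rate h N0 p (Suc i) = ln ((a (Suc i) + S (Suc i)) / (a (Suc i) + S i))"
    if "i < K" for i
    using that noma_rate_eq_ln_ratio[of h i N0 p "a (Suc i)"] p_nonneg h_nz \<open>N0 > 0\<close>
      sum_p[of i] sum_p[of "Suc i"] by (simp add: a_def)
  \<comment> \<open>\<open>D\<close> was chosen for this: \<open>D * E ^ (K - 1)\<close> is the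
    surplus \<open>P - M K\<close>, so the budget is used up exactly.\<close>
  have "S K = P"
    using \<open>K \<ge> 1\<close> \<open>E \<ge> 1\<close> by (simp add: S_def D_def)
  have "p \<in> noma_feasible K h N0 P r"
    unfolding noma_feasible_iff[OF \<open>K \<ge> 1\<close>]
  proof (intro conjI allI impI)
    show "p \<in> {1..K} \<rightarrow>\<^sub>E {0..}"
      using p_nonneg by (auto simp: PiE_iff p_def)
    show "(\<Sum>i = 1..K. p i) \<le> P"
      using sum_p[of K] \<open>S K = P\<close> by simp
    fix i assume "i < K"
    then show "r \<le> noma_rate h N0 p (Suc i)"
      using ratio_ge[of i] rate[of i] by (simp add: E_def ln_ge_iff less_le_trans[OF exp_gt_zero])
  qed
  moreover have "exp (noma_sum_rate K h N0 p) =
      exp (real K * r) + (P - noma_min_power K h N0 r) * (cmod (h 1))\<^sup>2 / N0"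
  proof -
    obtain n where K: "K = Suc n"
      using \<open>K \<ge> 1\<close> by (cases K) auto
    have "exp (noma_sum_rate K h N0 p) = (\<Prod>i<K. exp (noma_rate h N0 p (Suc i)))"
      by (simp add: noma_sum_rate_Suc exp_sum)
    also have "\<dots> = (\<Prod>i<K. if i = 0 then E + D / a 1 else E)"
    proof (rule prod.cong)
      fix i assume "i \<in> {..<K}"
      then have "i < K"
        by simp
      moreover have "(a (Suc i) + S (Suc i)) / (a (Suc i) + S i) > 0"
        using ratio_ge[OF \<open>i < K\<close>] \<open>E \<ge> 1\<close> by linarith
      ultimately show "exp (noma_rate h N0 p (Suc i)) = (if i = 0 then E + D / a 1 else E)"
        using rate ratio by (metis exp_ln)
    qed simp
    also have "\<dots> = (E + D / a 1) * E ^ n"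
      by (simp add: K prod.lessThan_Suc_shift del: prod.lessThan_Suc)
    also have "\<dots> = E ^ K + (P - M K) / a 1"
      using \<open>E \<ge> 1\<close> by (simp add: K D_def distrib_right)
    finally show ?thesis
      using M_K by (simp add: exp_of_nat_mult E_def a_def)
  qed
  ultimately show ?thesis
    by blast
qed

theorem theorem1:
  fixes K :: nat and N0 P r :: real and h :: "nat \<Rightarrow> complex"
  assumes "K \<ge> 1" and "N0 > 0" and "P > 0" and "r \<ge> 0"
    and "\<And>i. i \<in> {1..K} \<Longrightarrow> h i \<noteq> 0"
    and "\<And>i. i \<in> {1..<K} \<Longrightarrow> cmod (h i) \<ge> cmod (h (Suc i))"
    and "noma_min_power K h N0 r \<le> P"
  shows "noma_feasible K h N0 P r \<noteq> {} \<and>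
    noma_optimal_value K h N0 P r =
      ereal (real K * r +
        ln (1 + (P - noma_min_power K h N0 r) * (cmod (h 1))\<^sup>2 / (N0 * exp (real K * r)))) \<and>
    (\<exists>p \<in> noma_feasible K h N0 P r.
      ereal (noma_sum_rate K h N0 p) = noma_optimal_value K h N0 P r)"
proof -
  \<comment> \<open>\<open>B\<close> is the exponential of the claimed optimum, the form in which
    both the bound and its attainment are available; factoring out \<open>exp (real K * r)\<close>
    gives the stated logarithm.\<close>
  define B where "B = exp (real K * r) + (P - noma_min_power K h N0 r) * (cmod (h 1))\<^sup>2 / N0"
  have B_pos: "B > 0"
    unfolding B_def using assms(2,7) by (intro add_pos_nonneg) auto
  have "B = exp (real K * r) *
      (1 + (P - noma_min_power K h N0 r) * (cmod (h 1))\<^sup>2 / (N0 * exp (real K * r)))"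
    using assms(2) by (simp add: B_def field_simps)
  moreover have "1 + (P - noma_min_power K h N0 r) * (cmod (h 1))\<^sup>2 / (N0 * exp (real K * r)) > 0"
    using assms(2,7) by (intro add_pos_nonneg) auto
  ultimately have ln_B: "ln B = real K * r +
      ln (1 + (P - noma_min_power K h N0 r) * (cmod (h 1))\<^sup>2 / (N0 * exp (real K * r)))"
    by (simp add: ln_mult)
  obtain p where p: "p \<in> noma_feasible K h N0 P r" "exp (noma_sum_rate K h N0 p) = B"
    using noma_sum_rate_attained[OF assms(1,2,4,5,7)] by (auto simp: B_def)
  then have sum_rate_p: "noma_sum_rate K h N0 p = ln B"
    by (metis ln_exp)
  have "noma_sum_rate K h N0 q \<le> ln B" if "q \<in> noma_feasible K h N0 P r" for q
    using noma_sum_rate_le[OF assms(1,2,4,5,6) that] B_pos by (simp add: ln_ge_iff B_def)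
  \<comment> \<open>The bound on every feasible \<open>q\<close> gives one inequality, the maximizer
    \<open>p\<close> the other.\<close>
  then have "noma_optimal_value K h N0 P r = ereal (ln B)"
    unfolding noma_optimal_value_def using p(1) sum_rate_p
    by (intro antisym SUP_least) (auto intro: SUP_upper2)
  then show ?thesis
    using p(1) sum_rate_p ln_B by auto
qed

end
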